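(* Let $n\ge1$ and let $P(D)$ be a probability distribution on the weak-compositions of $n$. For every $t$, the distribution on permutations in $\mathfrak{S}_n$ after $t$ iterates of the $P$-shuffle-with-standardisation is the same as that after $t$ iterates of the $P$-shuffle-without-standardisation, if both are started from the identity permutation.
   Context: A weak-composition of $n$ is a finite list $D=(d_1,\dots,d_{l(D)})$ of non-negative integers with sum $n$. Permutations in $\mathfrak{S}_n$ are viewed in one-line notation $(\sigma(1),\dots,\sigma(n))$, i.e. as words; the identity is $(1,2,\dots,n)$. $P$-shuffle-with-standardisation chain on $\mathfrak{S}_n$: each step goes as follows. 1. Choose a weak-composition $D$ of $n$ with probability $P(D)$. 2. Deconcatenate the current permutation into a word $w_1$ of the first $d_1$ letters, $w_2$ of the next $d_2$ letters, and so on. 3. Replace the smallest letter in $w_1$ by $1$, the next smallest by $2$, and so on. Then replace the smallest letter in $w_2$ by $d_1+1$, the next smallest by $d_1+2$, and so on for all $w_i$. 4. Interleave these words uniformly, i.e. uniformly choose a permutation where the letters $1,\dots,d_1$ are in the same relative order as in the replaced $w_1$, the letters $d_1+1,\dots,d_1+d_2$ are in the same relative order as in the replaced $w_2$, etc. $P$-shuffle-without-standardisation chain on $\mathfrak{S}_n$: each step goes as follows. 1. Choose a weak-composition $D$ of $n$ with probability $P(D)$. 2. Deconcatenate the current permutation into a word $w_1$ of the first $d_1$ letters, $w_2$ of the next $d_2$ letters, and so on. 3. Interleave these words uniformly, i.e. uniformly choose a permutation where the letters of each $w_i$ stay in the same relative order. *)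

theory Defs
  imports "HOL-Probability.Probability" "HOL-Combinatorics.Multiset_Permutations"
begin

text \<open>
  A permutation of \<open>{1..n}\<close> is represented by its one-line notation, i.e. by an element of
  \<^term>\<open>permutations_of_set {1..n::nat}\<close>. Probability distributions are \<open>pmf\<close>s; this loses
  nothing since the sets of weak-compositions and of permutations are countable.
\<close>

definition weak_compositions :: "nat \<Rightarrow> nat list set" where
  "weak_compositions n = {D. sum_list D = n}"

definition identity_word :: "nat \<Rightarrow> nat list" where
  "identity_word n = [1..<Suc n]"

fun deconcatenate :: "nat list \<Rightarrow> 'a list \<Rightarrow> 'a list list" where
  "deconcatenate [] w = []"
| "deconcatenate (d # D) w = take d w # deconcatenate D (drop d w)"

text \<open>
  \<open>standardise_from k ws\<close> standardises the words one after the other: the \<open>j\<close>-th smallest letter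
  of the first word is replaced by \<open>k + j\<close>, and the letters of the next word start from
  \<open>k\<close> plus the length of the first word. The letters of each word are assumed distinct.
\<close>

fun standardise_from :: "nat \<Rightarrow> nat list list \<Rightarrow> nat list list" where
  "standardise_from k [] = []"
| "standardise_from k (v # ws) =
     map (\<lambda>x. k + card {y \<in> set v. y \<le> x}) v # standardise_from (k + length v) ws"

text \<open>The letters of each \<open>v\<close> occur in \<open>u\<close> in the same relative order as in \<open>v\<close>.\<close>

definition interleavings :: "nat \<Rightarrow> nat list list \<Rightarrow> nat list set" where
  "interleavings n ws =
     {u \<in> permutations_of_set {1..n}. \<forall>v \<in> set ws. filter (\<lambda>x. x \<in> set v) u = v}"

definition shuffle_with_std_step :: "nat \<Rightarrow> nat list pmf \<Rightarrow> nat list \<Rightarrow> nat list pmf" where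
  "shuffle_with_std_step n P w =
     bind_pmf P (\<lambda>D. pmf_of_set (interleavings n (standardise_from 0 (deconcatenate D w))))"

definition shuffle_without_std_step :: "nat \<Rightarrow> nat list pmf \<Rightarrow> nat list \<Rightarrow> nat list pmf" where
  "shuffle_without_std_step n P w =
     bind_pmf P (\<lambda>D. pmf_of_set (interleavings n (deconcatenate D w)))"

text \<open>Distribution after \<open>t\<close> steps of the chain with transition kernel \<open>K\<close>, started at \<open>x\<close>.\<close>

definition chain_dist :: "('a \<Rightarrow> 'a pmf) \<Rightarrow> 'a \<Rightarrow> nat \<Rightarrow> 'a pmf" where
  "chain_dist K x t = ((\<lambda>\<mu>. bind_pmf \<mu> K) ^^ t) (return_pmf x)"

text \<open>
  The sets of interleavings are finite and, in the situations that occur in the chains, nonempty,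
  so that \<^const>\<open>pmf_of_set\<close> is applied only where it denotes the uniform distribution.
\<close>

lemma finite_interleavings: "finite (interleavings n ws)"
  by (simp add: interleavings_def)

lemma concat_deconcatenate:
  "length w = sum_list D \<Longrightarrow> concat (deconcatenate D w) = w"
  by (induction D w rule: deconcatenate.induct) auto

lemma filter_set_concat:
  assumes "distinct (concat ws)" "v \<in> set ws"
  shows "filter (\<lambda>x. x \<in> set v) (concat ws) = v"
  using assms
proof (induction ws)
  case Nil
  then show ?case by simp
next
  case (Cons u ws)
  show ?case
  proof (cases "v = u")
    case True
    have "filter (\<lambda>x. x \<in> set u) (concat ws) = []"
      using Cons.prems(1) by (auto simp: filter_empty_conv)
    then show ?thesis using True by simp
  next
    case False
    then have v: "v \<in> set ws" using Cons.prems(2) by simp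
    then have "set v \<subseteq> set (concat ws)" by auto
    then have "filter (\<lambda>x. x \<in> set v) u = []"
      using Cons.prems(1) by (auto simp: filter_empty_conv)
    then show ?thesis using Cons.IH Cons.prems(1) v by simp
  qed
qed

lemma concat_in_interleavings:
  "concat ws \<in> permutations_of_set {1..n} \<Longrightarrow> concat ws \<in> interleavings n ws"
  by (auto simp: interleavings_def filter_set_concat dest: permutations_of_setD)

lemma rank_image:
  fixes S :: "nat set"
  assumes "finite S"
  shows "inj_on (\<lambda>x. card {y \<in> S. y \<le> x}) S"
    and "(\<lambda>x. card {y \<in> S. y \<le> x}) ` S = {1..card S}"
proof -
  have less: "card {y \<in> S. y \<le> x} < card {y \<in> S. y \<le> z}" if "z \<in> S" "x < z" for x z
  proof (rule psubset_card_mono)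
    show "finite {y \<in> S. y \<le> z}" using assms by simp
    have "z \<in> {y \<in> S. y \<le> z}" "z \<notin> {y \<in> S. y \<le> x}" using that by auto
    moreover have "{y \<in> S. y \<le> x} \<subseteq> {y \<in> S. y \<le> z}" using that by auto
    ultimately show "{y \<in> S. y \<le> x} \<subset> {y \<in> S. y \<le> z}" by blast
  qed
  show inj: "inj_on (\<lambda>x. card {y \<in> S. y \<le> x}) S"
  proof (rule inj_onI)
    fix x z assume "x \<in> S" "z \<in> S" "card {y \<in> S. y \<le> x} = card {y \<in> S. y \<le> z}"
    then show "x = z" using less[of z x] less[of x z] by (cases x z rule: linorder_cases) auto
  qed
  have "(\<lambda>x. card {y \<in> S. y \<le> x}) ` S \<subseteq> {1..card S}"
    using assms by (auto simp: Suc_le_eq card_gt_0_iff intro!: card_mono)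
  moreover have "card ((\<lambda>x. card {y \<in> S. y \<le> x}) ` S) = card {1..card S}"
    using card_image[OF inj] by simp
  ultimately show "(\<lambda>x. card {y \<in> S. y \<le> x}) ` S = {1..card S}"
    by (simp add: card_subset_eq)
qed

lemma concat_standardise_from:
  assumes "\<forall>v \<in> set ws. distinct v"
  shows "concat (standardise_from k ws) \<in> permutations_of_set {k + 1..k + length (concat ws)}"
  using assms
proof (induction k ws rule: standardise_from.induct)
  case (1 k)
  then show ?case by (simp add: permutations_of_set_def)
next
  case (2 k v ws)
  let ?r = "\<lambda>x. card {y \<in> set v. y \<le> x}"
  let ?a = "map (\<lambda>x. k + ?r x) v" and ?b = "concat (standardise_from (k + length v) ws)"
  have v: "distinct v" using 2(2) by simp
  have "set ?a = (+) k ` ?r ` set v" by (simp add: image_image)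
  also have "\<dots> = {k + 1..k + length v}"
    using rank_image(2)[of "set v"] distinct_card[OF v] by simp
  finally have a: "set ?a = {k + 1..k + length v}" .
  have da: "distinct ?a"
    using v rank_image(1)[of "set v"] by (auto simp: distinct_map inj_on_def)
  have b: "set ?b = {k + length v + 1..k + length v + length (concat ws)}" "distinct ?b"
    using permutations_of_setD[OF 2(1)] 2(2) by simp_all
  have "set (?a @ ?b) = {k + 1..k + length (concat (v # ws))}"
    unfolding set_append a b by auto
  moreover have "distinct (?a @ ?b)"
    unfolding distinct_append a b using da b(2) by auto
  ultimately show ?case by (simp add: permutations_of_set_def)
qed

lemma interleavings_nonempty:
  assumes "w \<in> permutations_of_set {1..n}" "D \<in> weak_compositions n"
  shows "interleavings n (deconcatenate D w) \<noteq> {}"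
    and "interleavings n (standardise_from 0 (deconcatenate D w)) \<noteq> {}"
proof -
  have w: "distinct w" "length w = n"
    using assms(1) by (auto dest: permutations_of_setD length_finite_permutations_of_set)
  then have c: "concat (deconcatenate D w) = w"
    using assms(2) by (simp add: concat_deconcatenate weak_compositions_def)
  show "interleavings n (deconcatenate D w) \<noteq> {}"
    using concat_in_interleavings[of "deconcatenate D w" n] assms(1) c by auto
  have "\<forall>v \<in> set (deconcatenate D w). distinct v"
    using w(1) c by (metis distinct_concat_iff)
  from concat_standardise_from[OF this, of 0] show
    "interleavings n (standardise_from 0 (deconcatenate D w)) \<noteq> {}"
    using concat_in_interleavings[of "standardise_from 0 (deconcatenate D w)" n] c w by auto
qed

end

theory Submission
  imports Defs
begin

text \<open>
  Interleaving the blocks of a word \<open>v\<close> cut by \<open>D\<close> amounts to drawing a uniform word \<open>g\<close> with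
  \<open>D ! k\<close> letters \<open>k\<close> and permuting \<open>v\<close> by the ranks of \<open>g\<close> (ties broken by position). Let \<open>gs\<close> be
  the list of the \<open>t\<close> independent words \<open>g\<close> drawn so far, and order the positions by comparing
  their columns in \<open>gs\<close> lexicographically. If the current permutation is the ranking for this
  order, then a step without standardisation appends \<open>g\<close> to \<open>gs\<close> as the least significant row,
  and a step with standardisation prepends it as the most significant row; in both cases the old
  rows are permuted by the ranks of \<open>g\<close>, which does not change their law because they are
  exchangeable. As the rows are independent and identically distributed, both chains have the law
  of the ranking of the same random matrix.
\<close>

section \<open>Ranking positions by a list of label words\<close>

text \<open>The head of the list is the most significant row; the base case breaks ties by position,
  so the relation is always a strict total order on positions.\<close>

fun lexless :: "nat list list \<Rightarrow> nat \<Rightarrow> nat \<Rightarrow> bool" where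
  "lexless [] i j \<longleftrightarrow> i < j"
| "lexless (g # gs) i j \<longleftrightarrow> g ! i < g ! j \<or> g ! i = g ! j \<and> lexless gs i j"

text \<open>Ranks count from 0 so that they are again positions. The value \<open>i\<close> outside
  \<open>{..<n}\<close> makes the function a permutation in the sense of
  \<open>permutes\<close>.\<close>

definition lex_rank :: "nat \<Rightarrow> nat list list \<Rightarrow> nat \<Rightarrow> nat" where
  "lex_rank n gs i = (if i < n then card {j. j < n \<and> lexless gs j i} else i)"

definition rank_word :: "nat \<Rightarrow> nat list list \<Rightarrow> nat list" where
  "rank_word n gs = map (\<lambda>i. Suc (lex_rank n gs i)) [0..<n]"

lemma lexless_irrefl: "\<not> lexless gs i i"
  by (induction gs) auto

lemma lexless_trans: "lexless gs i j \<Longrightarrow> lexless gs j k \<Longrightarrow> lexless gs i k"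
  by (induction gs) auto

lemma lexless_total: "i \<noteq> j \<Longrightarrow> lexless gs i j \<or> lexless gs j i"
  by (induction gs) auto

text \<open>By transitivity every predecessor of \<open>i\<close> precedes \<open>j\<close>, and
  \<open>i\<close> itself is a predecessor of \<open>j\<close> but not of \<open>i\<close>.\<close>

lemma lex_rank_mono:
  assumes "lexless gs i j" "i < n" "j < n"
  shows "lex_rank n gs i < lex_rank n gs j"
proof -
  have "card {k. k < n \<and> lexless gs k i} < card {k. k < n \<and> lexless gs k j}"
    using assms lexless_trans[of gs _ i j] lexless_irrefl[of gs i]
    by (intro psubset_card_mono) auto
  then show ?thesis using assms by (simp add: lex_rank_def)
qed

lemma lex_rank_less_iff:
  assumes "i < n" "j < n"
  shows "lex_rank n gs i < lex_rank n gs j \<longleftrightarrow> lexless gs i j"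
  using lex_rank_mono[of gs i j n] lex_rank_mono[of gs j i n] lexless_total[of i j gs] assms
    lexless_irrefl[of gs i] by (metis less_asym less_irrefl)

lemma lex_rank_less: "i < n \<Longrightarrow> lex_rank n gs i < n"
proof -
  assume i: "i < n"
  have "card {j. j < n \<and> lexless gs j i} < card {..<n}"
    using i lexless_irrefl[of gs i] by (intro psubset_card_mono) auto
  then show ?thesis using i by (simp add: lex_rank_def)
qed

lemma lex_rank_permutes: "lex_rank n gs permutes {..<n}"
proof (rule bij_imp_permutes)
  have "inj_on (lex_rank n gs) {..<n}"
    using lex_rank_mono lexless_total by (intro inj_onI) (metis lessThan_iff less_irrefl)
  moreover have "lex_rank n gs ` {..<n} \<subseteq> {..<n}" by (auto simp: lex_rank_less)
  ultimately show "bij_betw (lex_rank n gs) {..<n} {..<n}"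
    by (simp add: bij_betw_def endo_inj_surj)
qed (simp add: lex_rank_def)

lemma lex_rank_Nil: "lex_rank n [] = id"
proof
  fix i
  have "{j. j < n \<and> j < i} = {..<i}" if "i < n" using that by auto
  then show "lex_rank n [] i = id i" by (simp add: lex_rank_def)
qed

lemma length_rank_word [simp]: "length (rank_word n gs) = n"
  by (simp add: rank_word_def)

lemma nth_rank_word [simp]: "i < n \<Longrightarrow> rank_word n gs ! i = Suc (lex_rank n gs i)"
  by (simp add: rank_word_def)

lemma rank_word_permutation: "rank_word n gs \<in> permutations_of_set {1..n}"
proof -
  have "(\<lambda>i. Suc (lex_rank n gs i)) ` {0..<n} = Suc ` lex_rank n gs ` {..<n}"
    by (simp add: image_image lessThan_atLeast0)
  also have "\<dots> = {1..n}"
    by (simp add: permutes_image[OF lex_rank_permutes] image_Suc_lessThan)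
  finally have "set (rank_word n gs) = {1..n}" by (simp add: rank_word_def)
  moreover have "distinct (rank_word n gs)"
    using permutes_inj[OF lex_rank_permutes[of n gs]]
    by (auto simp: rank_word_def distinct_map inj_on_def)
  ultimately show ?thesis by (simp add: permutations_of_set_def)
qed

lemma rank_word_Nil: "rank_word n [] = identity_word n"
  by (simp add: rank_word_def lex_rank_Nil identity_word_def map_Suc_upt del: upt_Suc)

text \<open>A permutation is determined by the comparisons between its entries: each entry is one
  more than the number of smaller entries.\<close>

lemma permutation_eq_rank_word:
  assumes u: "u \<in> permutations_of_set {1..n}"
    and less: "\<And>i j. i < n \<Longrightarrow> j < n \<Longrightarrow> u ! i < u ! j \<longleftrightarrow> lexless gs i j"
  shows "u = rank_word n gs"
proof (rule nth_equalityI)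
  have su: "set u = {1..n}" and du: "distinct u" and lu: "length u = n"
    using u by (auto dest: permutations_of_setD length_finite_permutations_of_set)
  then show "length u = length (rank_word n gs)" by simp
  fix j assume "j < length u"
  then have j: "j < n" using lu by simp
  \<comment> \<open>Since \<open>u\<close> takes every value in \<open>{1..n}\<close>, the smaller
    entries exhaust all values below \<open>u ! j\<close>; counting them gives
    \<open>u ! j - 1\<close>.\<close>
  have "(!) u ` {i. i < n \<and> u ! i < u ! j} = {1..<u ! j}"
  proof (intro equalityI subsetI)
    fix x assume "x \<in> (!) u ` {i. i < n \<and> u ! i < u ! j}"
    then show "x \<in> {1..<u ! j}" using su lu by (auto dest: nth_mem)
  next
    fix x assume x: "x \<in> {1..<u ! j}"
    have "u ! j \<in> set u" using j lu by simp
    then have "x \<in> set u" using x su by auto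
    then show "x \<in> (!) u ` {i. i < n \<and> u ! i < u ! j}"
      using x lu by (auto simp: in_set_conv_nth)
  qed
  moreover have "inj_on ((!) u) {i. i < n \<and> u ! i < u ! j}"
    using du lu by (auto simp: inj_on_def nth_eq_iff_index_eq)
  ultimately have "card {i. i < n \<and> u ! i < u ! j} = u ! j - 1"
    by (metis card_image card_atLeastLessThan)
  moreover have "{i. i < n \<and> u ! i < u ! j} = {i. i < n \<and> lexless gs i j}"
    using less j by auto
  moreover have "u ! j \<ge> 1" using su lu j by (metis atLeastAtMost_iff nth_mem)
  ultimately show "u ! j = rank_word n gs ! j" using j by (simp add: lex_rank_def)
qed

lemma permute_list_permutation:
  assumes "p permutes {..<n}" "v \<in> permutations_of_set {1..n}"
  shows "permute_list p v \<in> permutations_of_set {1..n}"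
proof -
  have "length v = n" using assms(2) length_finite_permutations_of_set by fastforce
  then show ?thesis
    using assms by (auto simp: permutations_of_set_def)
qed

section \<open>Blocks and interleavings of a deconcatenation\<close>

text \<open>Index of the part of \<open>D\<close> that contains position \<open>m\<close>. Positions
  beyond the last part get the value \<open>length D\<close>.\<close>

fun block :: "nat list \<Rightarrow> nat \<Rightarrow> nat" where
  "block [] m = 0"
| "block (d # D) m = (if m < d then 0 else Suc (block D (m - d)))"

definition label_words :: "nat list \<Rightarrow> nat list set" where
  "label_words D = permutations_of_multiset (mset (map (block D) [0..<sum_list D]))"

lemma block_mono: "i \<le> j \<Longrightarrow> block D i \<le> block D j"
  by (induction D arbitrary: i j) auto

lemma block_less: "m < sum_list D \<Longrightarrow> block D m < length D"
  by (induction D arbitrary: m) auto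

lemma length_deconcatenate [simp]: "length (deconcatenate D v) = length D"
  by (induction D v rule: deconcatenate.induct) auto

text \<open>Removing the first part shifts the later positions by \<open>d\<close> and their block
  numbers by one, exactly as in the recursion of \<open>block\<close>.\<close>

lemma nth_deconcatenate:
  assumes "length v = sum_list D" "k < length D"
  shows "deconcatenate D v ! k = nths v {m. block D m = k}"
  using assms
proof (induction D arbitrary: v k)
  case (Cons d D)
  have "nths v {m. block (d # D) m = k} = nths (take d v @ drop d v) {m. block (d # D) m = k}"
    by simp
  also have "\<dots> = nths (take d v) {m. block (d # D) m = k} @
      nths (drop d v) {j. block (d # D) (j + d) = k}"
    using Cons.prems by (subst nths_append) (simp add: min_def)
  also have "\<dots> = deconcatenate (d # D) v ! k"
  proof (cases k)
    case 0
    have "nths (take d v) {m. block (d # D) m = k} = take d v"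
      using 0 by (intro nths_all) auto
    then show ?thesis using 0 by simp
  next
    case (Suc l)
    have "set (nths (take d v) {m. block (d # D) m = k}) = {}"
      using Suc by (auto simp: set_nths)
    then have "nths (take d v) {m. block (d # D) m = k} = []" by simp
    then show ?thesis using Suc Cons by simp
  qed
  finally show ?case ..
qed simp

lemma nth_mem_deconcatenate_iff:
  assumes "distinct v" "length v = sum_list D" "k < length D" "m < length v"
  shows "v ! m \<in> set (deconcatenate D v ! k) \<longleftrightarrow> block D m = k"
  using assms by (auto simp: nth_deconcatenate set_nths nth_eq_iff_index_eq)

text \<open>Moving each letter of \<open>g\<close> to its rank sorts \<open>g\<close>, and the
  sorted rearrangement is the nondecreasing sequence of block numbers. Hence \<open>g\<close> can be
  recovered from its rank permutation.\<close>

lemma label_words_nth_eq_block: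
  assumes g: "g \<in> label_words D" and i: "i < length g"
  shows "block D (lex_rank (length g) [g] i) = g ! i"
proof -
  let ?n = "length g"
  let ?p = "lex_rank ?n [g]"
  let ?h = "permute_list (inv ?p) g" and ?b = "map (block D) [0..<sum_list D]"
  have p: "?p permutes {..<?n}" by (rule lex_rank_permutes)
  have q: "inv ?p permutes {..<?n}" by (rule permutes_inv[OF p])
  have mg: "mset g = mset ?b"
    using g by (simp add: label_words_def permutations_of_multiset_def)
  then have n: "sum_list D = ?n" by (metis diff_zero length_map length_upt size_mset)
  have "sorted ?h"
    unfolding sorted_iff_nth_mono_less
  proof (intro allI impI)
    fix a b assume ab: "a < b" "b < length ?h"
    define a' b' where "a' = inv ?p a" and "b' = inv ?p b"
    have *: "a' < ?n" "b' < ?n" "?p a' = a" "?p b' = b"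
      using ab permutes_in_image[OF q] permutes_inverses(1)[OF p] by (auto simp: a'_def b'_def)
    then have "lexless [g] a' b'" using ab lex_rank_less_iff[of a' ?n b' "[g]"] by simp
    then show "?h ! a \<le> ?h ! b"
      using ab by (auto simp: permute_list_nth[OF q] a'_def b'_def)
  qed
  moreover have "sorted ?b"
    by (auto simp: sorted_iff_nth_mono_less intro: block_mono)
  moreover have "mset ?h = mset ?b" using mg q by simp
  \<comment> \<open>A multiset has only one sorted listing.\<close>
  ultimately have "?h = ?b" by (metis properties_for_sort)
  then have "?h ! ?p i = ?b ! ?p i" by simp
  then show ?thesis
    using i n lex_rank_less[OF i, of "[g]"]
    by (simp add: permute_list_nth[OF q] permutes_inverses(2)[OF p])
qed

section \<open>Interleavings as permutations increasing on each block\<close>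

lemma sorted_wrt_filter_iff:
  fixes xs :: "'a :: linorder list"
  assumes "sorted_wrt (<) xs"
  shows "sorted_wrt R (filter Q xs) \<longleftrightarrow>
    (\<forall>i\<in>set xs. \<forall>j\<in>set xs. i < j \<longrightarrow> Q i \<longrightarrow> Q j \<longrightarrow> R i j)"
  using assms by (induction xs) (auto dest: less_asym)

text \<open>The left filter reads \<open>v\<close> at the positions \<open>p i\<close> with
  \<open>B (p i)\<close>, for increasing \<open>i\<close>; the right one reads \<open>v\<close> at
  the same positions in increasing order. As \<open>v\<close> is distinct, they agree iff these
  \<open>p i\<close> increase.\<close>

lemma filter_permute_list_eq_iff:
  assumes p: "p permutes {..<n}" and v: "distinct v" "length v = n"
    and A: "\<And>m. m < n \<Longrightarrow> A (v ! m) \<longleftrightarrow> B m"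
  shows "filter A (permute_list p v) = filter A v \<longleftrightarrow>
    (\<forall>i j. i < j \<longrightarrow> j < n \<longrightarrow> B (p i) \<longrightarrow> B (p j) \<longrightarrow> p i < p j)"
proof -
  have pn: "p i < n" if "i < n" for i using permutes_in_image[OF p, of i] that by simp
  let ?I = "filter (\<lambda>i. B (p i)) [0..<n]" and ?J = "filter B [0..<n]"
  have "filter A (permute_list p v) = map ((!) v) (map p ?I)"
    using A pn v(2) by (auto simp: permute_list_def filter_map o_def intro!: map_cong filter_cong)
  moreover have "filter A v = map ((!) v) ?J"
  proof -
    have "filter A v = filter A (map ((!) v) [0..<n])" using v(2) map_nth[of v] by simp
    then show ?thesis using A by (auto simp: filter_map o_def intro!: map_cong filter_cong)
  qed
  moreover have "map ((!) v) (map p ?I) = map ((!) v) ?J \<longleftrightarrow> map p ?I = ?J"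
    using v pn by (intro inj_on_map_eq_map inj_on_nth) auto
  \<comment> \<open>Both lists have the same elements because \<open>p\<close> is onto
    \<open>{..<n}\<close>, and a strictly increasing list is determined by its set.\<close>
  moreover have "map p ?I = ?J \<longleftrightarrow> sorted_wrt (<) (map p ?I)"
  proof
    assume *: "map p ?I = ?J"
    show "sorted_wrt (<) (map p ?I)"
      unfolding * by (intro sorted_wrt_filter) simp
  next
    assume "sorted_wrt (<) (map p ?I)"
    moreover have "sorted_wrt (<) ?J" by (intro sorted_wrt_filter) simp
    moreover have "set (map p ?I) = {x \<in> p ` {..<n}. B x}" by auto
    then have "set (map p ?I) = set ?J" by (simp only: permutes_image[OF p]) auto
    ultimately show "map p ?I = ?J"
      by (intro strict_sorted_equal)
  qed
  moreover have "sorted_wrt (<) (map p ?I) \<longleftrightarrow>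
      (\<forall>i j. i < j \<longrightarrow> j < n \<longrightarrow> B (p i) \<longrightarrow> B (p j) \<longrightarrow> p i < p j)"
    by (subst sorted_wrt_map, subst sorted_wrt_filter_iff) auto
  ultimately show ?thesis by simp
qed

text \<open>One implication suffices: totality of \<open>lexless\<close> and asymmetry of
  \<open><\<close> on the values of \<open>p\<close> yield the converse.\<close>

lemma permutes_eq_lex_rank:
  assumes p: "p permutes {..<n}"
    and less: "\<And>i j. i < n \<Longrightarrow> j < n \<Longrightarrow> lexless gs i j \<Longrightarrow> p i < p j"
  shows "p = lex_rank n gs"
proof
  fix i
  \<comment> \<open>The entries of this word are \<open>Suc (p i)\<close>, so the uniqueness result
    for words applies to \<open>p\<close>.\<close>
  let ?u = "permute_list p (identity_word n)"
  have pn: "p i < n" if "i < n" for i using permutes_in_image[OF p, of i] that by simp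
  have l: "length (identity_word n) = n" by (simp add: identity_word_def)
  have u: "?u ! i = Suc (p i)" if "i < n" for i
    using that pn p l by (simp add: permute_list_nth identity_word_def del: upt_Suc)
  have "?u \<in> permutations_of_set {1..n}"
    using permute_list_permutation[OF p] rank_word_permutation[of n "[]"]
    by (simp add: rank_word_Nil)
  moreover have "?u ! i < ?u ! j \<longleftrightarrow> lexless gs i j" if "i < n" "j < n" for i j
    using that u less[of i j] less[of j i] lexless_total[of i j gs] lexless_irrefl[of gs i]
    by (cases "i = j") auto
  ultimately have "?u = rank_word n gs" by (rule permutation_eq_rank_word)
  then have "Suc (p i) = Suc (lex_rank n gs i)" if "i < n" using that u by (metis nth_rank_word)
  then show "p i = lex_rank n gs i"
    using permutes_not_in[OF p, of i] by (cases "i < n") (auto simp: lex_rank_def)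
qed

lemma permute_list_in_interleavings_iff:
  assumes p: "p permutes {..<n}" and v: "v \<in> permutations_of_set {1..n}" and D: "sum_list D = n"
  shows "permute_list p v \<in> interleavings n (deconcatenate D v) \<longleftrightarrow>
    (\<forall>i j. i < j \<longrightarrow> j < n \<longrightarrow> block D (p i) = block D (p j) \<longrightarrow> p i < p j)"
proof -
  let ?ws = "deconcatenate D v"
  have dv: "distinct v" and lv: "length v = n"
    using v by (auto dest: permutations_of_setD length_finite_permutations_of_set)
  have c: "concat ?ws = v" using lv D by (simp add: concat_deconcatenate)
  have pn: "p i < n" if "i < n" for i using permutes_in_image[OF p, of i] that by simp
  have "filter (\<lambda>x. x \<in> set (?ws ! k)) (permute_list p v) = ?ws ! k \<longleftrightarrow>
      (\<forall>i j. i < j \<longrightarrow> j < n \<longrightarrow> block D (p i) = k \<longrightarrow> block D (p j) = k \<longrightarrow> p i < p j)"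
    if k: "k < length D" for k
  proof -
    have "filter (\<lambda>x. x \<in> set (?ws ! k)) v = ?ws ! k"
      using filter_set_concat[of ?ws "?ws ! k"] c dv k by simp
    then show ?thesis
      using filter_permute_list_eq_iff[OF p dv lv, of "\<lambda>x. x \<in> set (?ws ! k)" "\<lambda>m. block D m = k"]
        nth_mem_deconcatenate_iff[OF dv _ k] lv D by simp
  qed
  moreover have "permute_list p v \<in> interleavings n ?ws \<longleftrightarrow>
      (\<forall>k<length D. filter (\<lambda>x. x \<in> set (?ws ! k)) (permute_list p v) = ?ws ! k)"
    using permute_list_permutation[OF p v] by (simp add: interleavings_def all_set_conv_all_nth)
  \<comment> \<open>Every position belongs to some part of \<open>D\<close>, so the conditions for
    the single \<open>k\<close> merge into one condition on pairs with equal block.\<close>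
  moreover have "block D (p j) < length D" if "j < n" for j
    using block_less[of "p j" D] pn[OF that] D by simp
  ultimately show ?thesis by metis
qed

lemma label_words_length: "g \<in> label_words D \<Longrightarrow> length g = sum_list D"
  unfolding label_words_def permutations_of_multiset_def
  by (metis (mono_tags) diff_zero length_map length_upt mem_Collect_eq size_mset)

text \<open>Injective because \<open>g ! i\<close> is the block of the rank of \<open>i\<close>.
  Surjective because an interleaving can be labelled by the blocks its letters come from, and
  keeping the order inside blocks makes the rearrangement the rank permutation of these
  labels.\<close>

lemma bij_betw_label_words_interleavings:
  assumes v: "v \<in> permutations_of_set {1..n}" and D: "sum_list D = n"
  shows "bij_betw (\<lambda>g. permute_list (lex_rank n [g]) v) (label_words D)
    (interleavings n (deconcatenate D v))"
  unfolding bij_betw_def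
proof (intro conjI inj_onI equalityI subsetI)
  have dv: "distinct v" and lv: "length v = n"
    using v by (auto dest: permutations_of_setD length_finite_permutations_of_set)
  have inv: "block D (lex_rank n [g] i) = g ! i" if "g \<in> label_words D" "i < n" for g i
    using label_words_nth_eq_block[OF that(1)] label_words_length[OF that(1)] D that(2) by simp
  {
    fix g h assume g: "g \<in> label_words D" and h: "h \<in> label_words D"
      and eq: "permute_list (lex_rank n [g]) v = permute_list (lex_rank n [h]) v"
    show "g = h"
    proof (rule nth_equalityI)
      show "length g = length h" using g h by (simp add: label_words_length)
      fix i assume "i < length g"
      then have i: "i < n" using g D by (simp add: label_words_length)
      from eq have "permute_list (lex_rank n [g]) v ! i = permute_list (lex_rank n [h]) v ! i"
        by simp
      then have "lex_rank n [g] i = lex_rank n [h] i"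
        using i lv dv by (simp add: permute_list_nth lex_rank_permutes nth_eq_iff_index_eq lex_rank_less)
      then show "g ! i = h ! i" using inv g h i by metis
    qed
  next
    fix u assume "u \<in> (\<lambda>g. permute_list (lex_rank n [g]) v) ` label_words D"
    then obtain g where g: "g \<in> label_words D" and u: "u = permute_list (lex_rank n [g]) v"
      by auto
    show "u \<in> interleavings n (deconcatenate D v)"
      unfolding u permute_list_in_interleavings_iff[OF lex_rank_permutes v D]
      using inv[OF g] by (auto intro: lex_rank_mono)
  next
    fix u assume u: "u \<in> interleavings n (deconcatenate D v)"
    then have "u \<in> permutations_of_set {1..n}" by (simp add: interleavings_def)
    then have "mset u = mset v"
      using v by (metis permutations_of_setD set_eq_iff_mset_eq_distinct)
    then obtain p where p: "p permutes {..<n}" and up: "u = permute_list p v"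
      by (metis mset_eq_permutation lv)
    have pn: "p i < n" if "i < n" for i using permutes_in_image[OF p, of i] that by simp
    \<comment> \<open>Here \<open>p i\<close> is the position in \<open>v\<close> of the letter
      \<open>u ! i\<close>, so \<open>g ! i\<close> is the block of that letter.\<close>
    define g where "g = permute_list p (map (block D) [0..<sum_list D])"
    have gi: "g ! i = block D (p i)" if "i < n" for i
      using that pn p D by (simp add: g_def permute_list_nth)
    have "g \<in> label_words D"
      using p D by (simp add: label_words_def permutations_of_multiset_def g_def)
    moreover have "p = lex_rank n [g]"
    proof (rule permutes_eq_lex_rank[OF p])
      fix i j assume ij: "i < n" "j < n" "lexless [g] i j"
      \<comment> \<open>Different labels are settled by monotonicity of \<open>block\<close>, equal
        ones by the interleaving condition.\<close>
      have "p i < p j" if "block D (p i) < block D (p j)"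
        using that block_mono[of "p j" "p i" D] by (meson leD leI)
      moreover have "p i < p j" if "block D (p i) = block D (p j)" "i < j"
        using that ij u unfolding up permute_list_in_interleavings_iff[OF p v D] by blast
      ultimately show "p i < p j" using ij gi by auto
    qed
    ultimately show "u \<in> (\<lambda>g. permute_list (lex_rank n [g]) v) ` label_words D"
      using up by blast
  }
qed

section \<open>The order of letters after standardisation\<close>

text \<open>Letters of an earlier word stay below those of a later one, and inside a word the
  replacement by ranks preserves order. Standardising thus makes the block number the primary key
  and the old letter the secondary one.\<close>

lemma nth_concat_standardise_less_iff:
  assumes "distinct w" "length w = sum_list D" "i < length w" "j < length w"
  shows "concat (standardise_from k (deconcatenate D w)) ! i
      < concat (standardise_from k (deconcatenate D w)) ! j \<longleftrightarrow>
    block D i < block D j \<or> block D i = block D j \<and> w ! i < w ! j"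
  using assms
proof (induction D arbitrary: k w i j)
  case (Cons d D)
  let ?r = "\<lambda>x. card {y \<in> set (take d w). y \<le> x}"
  let ?b = "concat (standardise_from (k + d) (deconcatenate D (drop d w)))"
  let ?s = "concat (standardise_from k (deconcatenate (d # D) w))"
  have d: "d \<le> length w" using Cons.prems(2) by simp
  have s: "?s = map (\<lambda>x. k + ?r x) (take d w) @ ?b" using d by (simp add: min_def)
  have s1: "?s ! m = k + ?r (w ! m)" if "m < d" for m
    unfolding s using that d by (simp add: nth_append min_def)
  have s2: "?s ! m = ?b ! (m - d)" if "\<not> m < d" for m
    unfolding s using that d by (simp add: nth_append min_def)
  have c: "concat (deconcatenate D (drop d w)) = drop d w"
    using Cons.prems(2) by (intro concat_deconcatenate) simp
  then have "\<forall>v \<in> set (deconcatenate D (drop d w)). distinct v"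
    using Cons.prems(1) by (metis distinct_concat_iff distinct_drop)
  from concat_standardise_from[OF this, of "k + d"]
  have b: "?b \<in> permutations_of_set {k + d + 1..k + d + (length w - d)}" by (simp add: c)
  have sb: "set ?b = {k + d + 1..k + d + (length w - d)}" by (rule permutations_of_setD(1)[OF b])
  have lb: "length ?b = length w - d" using length_finite_permutations_of_set[OF b] by simp
  \<comment> \<open>The value \<open>k + d\<close> separates the letters of the first word from
    those of all later words.\<close>
  have big: "?s ! m > k + d" if "\<not> m < d" "m < length w" for m
  proof -
    have "?b ! (m - d) \<in> set ?b" using that lb by (intro nth_mem) simp
    then have "?b ! (m - d) \<in> {k + d + 1..k + d + (length w - d)}" by (simp only: sb)
    then show ?thesis unfolding s2[OF that(1)] by simp
  qed
  have small: "?s ! m \<le> k + d" if "m < d" for m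
  proof -
    have "?r (w ! m) \<le> card (set (take d w))" by (intro card_mono) auto
    also have "\<dots> \<le> d" using card_length[of "take d w"] by simp
    finally show ?thesis using s1[OF that] by simp
  qed
  have mono: "?r x < ?r z" if "z \<in> set (take d w)" "x < z" for x z
  proof (rule psubset_card_mono)
    have "z \<in> {y \<in> set (take d w). y \<le> z}" "z \<notin> {y \<in> set (take d w). y \<le> x}"
      using that by auto
    moreover have "{y \<in> set (take d w). y \<le> x} \<subseteq> {y \<in> set (take d w). y \<le> z}"
      using that by auto
    ultimately show "{y \<in> set (take d w). y \<le> x} \<subset> {y \<in> set (take d w). y \<le> z}"
      by blast
  qed simp
  consider "i < d" "j < d" | "i < d" "\<not> j < d" | "\<not> i < d" "j < d" | "\<not> i < d" "\<not> j < d"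
    by blast
  then show ?case
  proof cases
    case 1
    then have "w ! i \<in> set (take d w)" "w ! j \<in> set (take d w)"
      using d nth_mem[of i "take d w"] nth_mem[of j "take d w"] by simp_all
    then have "?r (w ! i) < ?r (w ! j) \<longleftrightarrow> w ! i < w ! j"
      using mono[of "w ! j" "w ! i"] mono[of "w ! i" "w ! j"]
      by (cases "w ! i" "w ! j" rule: linorder_cases) auto
    then show ?thesis unfolding s1[OF 1(1)] s1[OF 1(2)] using 1 by simp
  next
    case 2
    then show ?thesis using small[of i] big[of j] Cons.prems by simp
  next
    case 3
    then show ?thesis using small[of j] big[of i] Cons.prems by simp
  next
    case 4
    have "?b ! (i - d) < ?b ! (j - d) \<longleftrightarrow> block D (i - d) < block D (j - d) \<or>
        block D (i - d) = block D (j - d) \<and> drop d w ! (i - d) < drop d w ! (j - d)"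
      using Cons.prems 4 by (intro Cons.IH) auto
    then show ?thesis unfolding s2[OF 4(1)] s2[OF 4(2)] using 4 d Cons.prems by simp
  qed
qed simp

text \<open>Standardising keeps word lengths, so the standardised words are themselves the blocks of
  one permutation and the bijection with label words applies to them.\<close>

lemma deconcatenate_concat_standardise:
  assumes "length w = sum_list D"
  shows "deconcatenate D (concat (standardise_from k (deconcatenate D w))) =
    standardise_from k (deconcatenate D w)"
  using assms by (induction D arbitrary: k w) (auto simp: min_def)

section \<open>One step of the chains\<close>

lemma lexless_snoc_eq: "g ! i = g ! j \<Longrightarrow> lexless (gs @ [g]) i j \<longleftrightarrow> lexless gs i j"
  by (induction gs) auto

text \<open>Column \<open>i\<close> of the permuted rows is column \<open>p i\<close> of
  \<open>gs\<close>. If these columns tie, the comparison of positions \<open>p i\<close> and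
  \<open>p j\<close> becomes the comparison by the last row \<open>g\<close>.\<close>

lemma lexless_permute_snoc:
  assumes p: "p permutes {..<n}" and gs: "\<forall>h \<in> set gs. length h = n" and ij: "i < n" "j < n"
    and g: "p i < p j \<longleftrightarrow> lexless [g] i j"
  shows "lexless (map (permute_list p) gs @ [g]) i j \<longleftrightarrow> lexless gs (p i) (p j)"
  using gs
proof (induction gs)
  case Nil
  then show ?case using g by simp
next
  case (Cons h gs)
  then show ?case using p ij by (simp add: permute_list_nth)
qed

text \<open>The old order of the letters decides first; \<open>g\<close> enters only through the
  tie-break by position, hence as the least significant row.\<close>

lemma permute_rank_word:
  assumes gs: "\<forall>h \<in> set gs. length h = n"
  shows "permute_list (lex_rank n [g]) (rank_word n gs) =
    rank_word n (map (permute_list (lex_rank n [g])) gs @ [g])"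
proof (rule permutation_eq_rank_word)
  let ?p = "lex_rank n [g]"
  show "permute_list ?p (rank_word n gs) \<in> permutations_of_set {1..n}"
    by (rule permute_list_permutation[OF lex_rank_permutes rank_word_permutation])
  fix i j assume ij: "i < n" "j < n"
  show "permute_list ?p (rank_word n gs) ! i < permute_list ?p (rank_word n gs) ! j \<longleftrightarrow>
      lexless (map (permute_list ?p) gs @ [g]) i j"
    using ij gs lexless_permute_snoc[OF lex_rank_permutes gs ij lex_rank_less_iff[OF ij]]
    by (simp add: permute_list_nth lex_rank_permutes lex_rank_less lex_rank_less_iff)
qed

lemma concat_standardise_permutation:
  assumes w: "w \<in> permutations_of_set {1..n}" and D: "sum_list D = n"
  shows "concat (standardise_from 0 (deconcatenate D w)) \<in> permutations_of_set {1..n}"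
proof -
  have w': "distinct w" "length w = n"
    using w by (auto dest: permutations_of_setD length_finite_permutations_of_set)
  then have c: "concat (deconcatenate D w) = w" using D by (simp add: concat_deconcatenate)
  then have "\<forall>v \<in> set (deconcatenate D w). distinct v" using w' by (metis distinct_concat_iff)
  from concat_standardise_from[OF this, of 0] show ?thesis using c w' by simp
qed

text \<open>After standardisation the block decides first, and the letter placed at \<open>i\<close>
  has block \<open>g ! i\<close>; so \<open>g\<close> becomes the most significant row.\<close>

lemma permute_standardised_rank_word:
  assumes gs: "\<forall>h \<in> set gs. length h = n" and g: "g \<in> label_words D" and D: "sum_list D = n"
  shows "permute_list (lex_rank n [g])
      (concat (standardise_from 0 (deconcatenate D (rank_word n gs)))) =
    rank_word n (g # map (permute_list (lex_rank n [g])) gs)"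
proof (rule permutation_eq_rank_word)
  let ?p = "lex_rank n [g]" and ?w = "rank_word n gs"
  let ?s = "concat (standardise_from 0 (deconcatenate D ?w))"
  have s: "?s \<in> permutations_of_set {1..n}"
    by (rule concat_standardise_permutation[OF rank_word_permutation D])
  show "permute_list ?p ?s \<in> permutations_of_set {1..n}"
    by (rule permute_list_permutation[OF lex_rank_permutes s])
  fix i j assume ij: "i < n" "j < n"
  have l: "length ?s = n" using length_finite_permutations_of_set[OF s] by simp
  have b: "block D (?p m) = g ! m" if "m < n" for m
    using label_words_nth_eq_block[OF g] label_words_length[OF g] D that by simp
  have "permute_list ?p ?s ! i < permute_list ?p ?s ! j \<longleftrightarrow> ?s ! ?p i < ?s ! ?p j"
    using ij l by (simp only: permute_list_nth lex_rank_permutes)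
  also have "\<dots> \<longleftrightarrow> g ! i < g ! j \<or> g ! i = g ! j \<and> ?w ! ?p i < ?w ! ?p j"
    using ij D permutations_of_setD(2)[OF rank_word_permutation]
    by (subst nth_concat_standardise_less_iff) (auto simp: lex_rank_less b)
  also have "\<dots> \<longleftrightarrow> lexless (g # map (permute_list ?p) gs) i j"
    using lexless_permute_snoc[OF lex_rank_permutes gs ij lex_rank_less_iff[OF ij]]
      lexless_snoc_eq[of g i j "map (permute_list ?p) gs"] ij
    by (auto simp: lex_rank_less lex_rank_less_iff)
  finally show "permute_list ?p ?s ! i < permute_list ?p ?s ! j \<longleftrightarrow>
      lexless (g # map (permute_list ?p) gs) i j" .
qed

definition label_pmf :: "nat list pmf \<Rightarrow> nat list pmf" where
  "label_pmf P = bind_pmf P (\<lambda>D. pmf_of_set (label_words D))"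

lemma label_words_finite: "finite (label_words D)"
  by (simp add: label_words_def)

lemma label_words_nonempty: "label_words D \<noteq> {}"
  by (simp add: label_words_def)

lemma pmf_of_set_interleavings:
  assumes "v \<in> permutations_of_set {1..n}" "sum_list D = n"
  shows "pmf_of_set (interleavings n (deconcatenate D v)) =
    map_pmf (\<lambda>g. permute_list (lex_rank n [g]) v) (pmf_of_set (label_words D))"
  using map_pmf_of_set_bij_betw[OF bij_betw_label_words_interleavings[OF assms]
      label_words_nonempty label_words_finite] by simp

lemma shuffle_without_std_step_rank_word:
  assumes P: "set_pmf P \<subseteq> weak_compositions n" and gs: "\<forall>h \<in> set gs. length h = n"
  shows "shuffle_without_std_step n P (rank_word n gs) =
    map_pmf (\<lambda>g. rank_word n (map (permute_list (lex_rank n [g])) gs @ [g])) (label_pmf P)"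
  unfolding shuffle_without_std_step_def label_pmf_def map_bind_pmf
proof (intro bind_pmf_cong refl)
  fix D assume "D \<in> set_pmf P"
  then have D: "sum_list D = n" using P by (auto simp: weak_compositions_def)
  show "pmf_of_set (interleavings n (deconcatenate D (rank_word n gs))) =
      map_pmf (\<lambda>g. rank_word n (map (permute_list (lex_rank n [g])) gs @ [g]))
        (pmf_of_set (label_words D))"
    by (simp add: pmf_of_set_interleavings[OF rank_word_permutation D] permute_rank_word[OF gs])
qed

lemma shuffle_with_std_step_rank_word:
  assumes P: "set_pmf P \<subseteq> weak_compositions n" and gs: "\<forall>h \<in> set gs. length h = n"
  shows "shuffle_with_std_step n P (rank_word n gs) =
    map_pmf (\<lambda>g. rank_word n (g # map (permute_list (lex_rank n [g])) gs)) (label_pmf P)"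
  unfolding shuffle_with_std_step_def label_pmf_def map_bind_pmf
proof (intro bind_pmf_cong refl)
  fix D assume "D \<in> set_pmf P"
  then have D: "sum_list D = n" using P by (auto simp: weak_compositions_def)
  let ?s = "concat (standardise_from 0 (deconcatenate D (rank_word n gs)))"
  have "?s \<in> permutations_of_set {1..n}"
    by (rule concat_standardise_permutation[OF rank_word_permutation D])
  then have "pmf_of_set (interleavings n (deconcatenate D ?s)) =
      map_pmf (\<lambda>g. permute_list (lex_rank n [g]) ?s) (pmf_of_set (label_words D))"
    using D by (rule pmf_of_set_interleavings)
  then show "pmf_of_set (interleavings n (standardise_from 0 (deconcatenate D (rank_word n gs)))) =
      map_pmf (\<lambda>g. rank_word n (g # map (permute_list (lex_rank n [g])) gs))
        (pmf_of_set (label_words D))"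
    using permute_standardised_rank_word[OF gs _ D] D
    by (auto simp: deconcatenate_concat_standardise label_words_finite label_words_nonempty
        intro!: map_pmf_cong)
qed

section \<open>The random label matrix\<close>

fun labels_pmf :: "nat list pmf \<Rightarrow> nat \<Rightarrow> nat list list pmf" where
  "labels_pmf P 0 = return_pmf []"
| "labels_pmf P (Suc t) = bind_pmf (label_pmf P) (\<lambda>g. map_pmf ((#) g) (labels_pmf P t))"

text \<open>The rows are independent and identically distributed, so the new row may be drawn at the
  other end; the induction swaps the draws of the first and last rows.\<close>

lemma labels_pmf_Suc_snoc:
  "labels_pmf P (Suc t) = bind_pmf (label_pmf P) (\<lambda>g. map_pmf (\<lambda>gs. gs @ [g]) (labels_pmf P t))"
proof (induction t)
  case 0
  show ?case by simp
next
  case (Suc t)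
  have "labels_pmf P (Suc (Suc t)) = bind_pmf (label_pmf P) (\<lambda>h. bind_pmf (label_pmf P) (\<lambda>g.
      map_pmf (\<lambda>gs. h # gs @ [g]) (labels_pmf P t)))"
    by (subst labels_pmf.simps(2), subst Suc.IH) (simp add: map_bind_pmf pmf.map_comp o_def)
  also have "\<dots> = bind_pmf (label_pmf P) (\<lambda>g. bind_pmf (label_pmf P) (\<lambda>h.
      map_pmf (\<lambda>gs. h # gs @ [g]) (labels_pmf P t)))"
    by (rule bind_commute_pmf)
  also have "\<dots> = bind_pmf (label_pmf P) (\<lambda>g. map_pmf (\<lambda>gs. gs @ [g]) (labels_pmf P (Suc t)))"
    by (simp add: map_bind_pmf pmf.map_comp o_def)
  finally show ?case .
qed

section \<open>Exchangeability of the labels\<close>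

text \<open>Permuting positions preserves the multiset of letters, so it is a bijection of
  \<open>label_words D\<close> with inverse given by \<open>inv p\<close>, and the uniform law is
  invariant.\<close>

lemma label_words_exchangeable:
  assumes p: "p permutes {..<sum_list D}"
  shows "map_pmf (permute_list p) (pmf_of_set (label_words D)) = pmf_of_set (label_words D)"
proof (rule map_pmf_of_set_bij_betw[OF _ label_words_nonempty label_words_finite])
  have *: "permute_list q ` label_words D \<subseteq> label_words D" if "q permutes {..<sum_list D}" for q
    using that label_words_length
    by (auto simp: label_words_def permutations_of_multiset_def)
  have q: "inv p permutes {..<sum_list D}" by (rule permutes_inv[OF p])
  show "bij_betw (permute_list p) (label_words D) (label_words D)"
    using *[OF p] *[OF q]
    by (intro bij_betw_byWitness[where f' = "permute_list (inv p)"])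
      (auto simp: label_words_length p q permute_list_compose[symmetric] permutes_inv_o[OF p])
qed

lemma label_pmf_exchangeable:
  assumes "set_pmf P \<subseteq> weak_compositions n" "p permutes {..<n}"
  shows "map_pmf (permute_list p) (label_pmf P) = label_pmf P"
  unfolding label_pmf_def map_bind_pmf
  using assms by (intro bind_pmf_cong refl label_words_exchangeable) (auto simp: weak_compositions_def)

text \<open>The same permutation acts on every row; by independence, invariance of the law of each
  row gives that of the matrix.\<close>

lemma labels_pmf_exchangeable:
  assumes "set_pmf P \<subseteq> weak_compositions n" "p permutes {..<n}"
  shows "map_pmf (map (permute_list p)) (labels_pmf P t) = labels_pmf P t"
proof (induction t)
  case (Suc t)
  have "map_pmf (map (permute_list p)) (labels_pmf P (Suc t)) =
      bind_pmf (label_pmf P) (\<lambda>g. map_pmf ((#) (permute_list p g))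
        (map_pmf (map (permute_list p)) (labels_pmf P t)))"
    by (simp add: map_bind_pmf pmf.map_comp o_def)
  also have "\<dots> = bind_pmf (map_pmf (permute_list p) (label_pmf P))
      (\<lambda>g. map_pmf ((#) g) (labels_pmf P t))"
    by (simp add: Suc bind_map_pmf)
  also have "\<dots> = labels_pmf P (Suc t)"
    by (simp add: label_pmf_exchangeable[OF assms])
  finally show ?case .
qed simp

lemma labels_pmf_length:
  assumes P: "set_pmf P \<subseteq> weak_compositions n"
  shows "gs \<in> set_pmf (labels_pmf P t) \<Longrightarrow> \<forall>h \<in> set gs. length h = n"
proof (induction t arbitrary: gs)
  case (Suc t)
  have "length g = n" if "g \<in> set_pmf (label_pmf P)" for g
    using that P label_words_length
    by (fastforce simp: label_pmf_def weak_compositions_def label_words_finite label_words_nonempty)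
  then show ?case using Suc by auto
qed simp

text \<open>Covers both chains: \<open>ext\<close> is either \<open>\<lambda>gs g. g # gs\<close> or \<open>\<lambda>gs g. gs @ [g]\<close>.\<close>

lemma chain_dist_eq_labels_pmf:
  assumes P: "set_pmf P \<subseteq> weak_compositions n"
    and step: "\<And>gs. \<forall>h \<in> set gs. length h = n \<Longrightarrow> K (rank_word n gs) =
      map_pmf (\<lambda>g. rank_word n (ext (map (permute_list (lex_rank n [g])) gs) g)) (label_pmf P)"
    and ext: "\<And>t. labels_pmf P (Suc t) =
      bind_pmf (label_pmf P) (\<lambda>g. map_pmf (\<lambda>gs. ext gs g) (labels_pmf P t))"
  shows "chain_dist K (identity_word n) t = map_pmf (rank_word n) (labels_pmf P t)"
proof (induction t)
  case 0
  show ?case by (simp add: chain_dist_def rank_word_Nil)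
next
  case (Suc t)
  let ?M = "labels_pmf P t" and ?p = "\<lambda>g. lex_rank n [g]"
  have "chain_dist K (identity_word n) (Suc t) = bind_pmf (chain_dist K (identity_word n) t) K"
    by (simp add: chain_dist_def)
  also have "\<dots> = bind_pmf ?M (\<lambda>gs. K (rank_word n gs))"
    by (simp add: Suc bind_map_pmf)
  also have "\<dots> = bind_pmf ?M (\<lambda>gs. bind_pmf (label_pmf P)
      (\<lambda>g. return_pmf (rank_word n (ext (map (permute_list (?p g)) gs) g))))"
    using labels_pmf_length[OF P] step
    by (intro bind_pmf_cong refl) (simp add: map_pmf_def)
  \<comment> \<open>Drawing \<open>g\<close> first makes the permutation \<open>?p g\<close> fixed
    relative to the old rows, so exchangeability applies for each \<open>g\<close>
    separately.\<close>
  also have "\<dots> = bind_pmf (label_pmf P) (\<lambda>g. bind_pmf ?M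
      (\<lambda>gs. return_pmf (rank_word n (ext (map (permute_list (?p g)) gs) g))))"
    by (rule bind_commute_pmf)
  also have "\<dots> = bind_pmf (label_pmf P) (\<lambda>g. map_pmf (\<lambda>gs. rank_word n (ext gs g))
      (map_pmf (map (permute_list (?p g))) ?M))"
    by (simp add: map_pmf_def bind_assoc_pmf bind_return_pmf)
  also have "\<dots> = map_pmf (rank_word n) (labels_pmf P (Suc t))"
    by (simp only: ext labels_pmf_exchangeable[OF P lex_rank_permutes] map_bind_pmf pmf.map_comp o_def)
  finally show ?case .
qed

theorem theorem3p14:
  fixes n t :: nat and P :: "nat list pmf"
  assumes "n \<ge> 1"
    and "set_pmf P \<subseteq> weak_compositions n"
  shows "chain_dist (shuffle_with_std_step n P) (identity_word n) t =
         chain_dist (shuffle_without_std_step n P) (identity_word n) t"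
proof -
  have "chain_dist (shuffle_with_std_step n P) (identity_word n) t =
      map_pmf (rank_word n) (labels_pmf P t)"
    \<comment> \<open>Prepending matches the defining recursion of \<open>labels_pmf\<close>; the
      appending chain below relies on \<open>labels_pmf_Suc_snoc\<close>.\<close>
    by (rule chain_dist_eq_labels_pmf[where ext = "\<lambda>gs g. g # gs", OF assms(2)])
      (simp_all add: shuffle_with_std_step_rank_word[OF assms(2)])
  moreover have "chain_dist (shuffle_without_std_step n P) (identity_word n) t =
      map_pmf (rank_word n) (labels_pmf P t)"
    by (rule chain_dist_eq_labels_pmf[where ext = "\<lambda>gs g. gs @ [g]", OF assms(2)
          shuffle_without_std_step_rank_word[OF assms(2)] labels_pmf_Suc_snoc])
  ultimately show ?thesis by simp
qed

end
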